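(* Let $B\ge1$ be an integer and let $0<\theta<1$ be irrational with partial quotients bounded by $B$. Let ${\bf s}=(s_i)_{i\ge0}$ with $s_i=\lfloor (i+2)\theta\rfloor-\lfloor (i+1)\theta\rfloor$. Then the function $r\mapsto 2(B+2)^2r^2$ is a diversity measure for ${\bf s}$; that is, for all integers $r,a,b$ with $0\le a<b<r$, the sequences $(s_{ri+a})_{i\ge0}$ and $(s_{ri+b})_{i\ge0}$ are distinct and $\min\{i: s_{ri+a}\ne s_{ri+b}\}\le 2(B+2)^2r^2$.
   Context: $\theta=[a_0;a_1,\ldots]$ has partial quotients bounded by $B$ if $|a_i|\le B$ for all $i\ge1$. For distinct sequences ${\bf t},{\bf u}$ the agreement is ${\rm ag}({\bf t},{\bf u})=\min\{i:t_i\ne u_i\}$; a function $g$ is a diversity measure for ${\bf s}$ if for all $r,a,b$ with $0\le a<b<r$, ${\rm ag}((s_{ri+a})_{i\ge0},(s_{ri+b})_{i\ge0})\le g(r)$. *)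

theory Defs
  imports Complex_Main
begin

text \<open>Complete quotients of the regular continued fraction expansion. The recursion is only
  meaningful as long as the fractional part is nonzero, so for irrational \<open>\<theta>\<close> at every index.\<close>

primrec complete_quotient :: "real \<Rightarrow> nat \<Rightarrow> real" where
  "complete_quotient \<theta> 0 = \<theta>"
| "complete_quotient \<theta> (Suc n) = 1 / frac (complete_quotient \<theta> n)"

definition partial_quotient :: "real \<Rightarrow> nat \<Rightarrow> int" where
  "partial_quotient \<theta> n = \<lfloor>complete_quotient \<theta> n\<rfloor>"

definition partial_quotients_bounded_by :: "real \<Rightarrow> nat \<Rightarrow> bool" where
  "partial_quotients_bounded_by \<theta> B \<longleftrightarrow> (\<forall>i\<ge>1. \<bar>partial_quotient \<theta> i\<bar> \<le> int B)"

text \<open>Only meaningful for distinct sequences.\<close>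

definition agreement :: "(nat \<Rightarrow> 'a) \<Rightarrow> (nat \<Rightarrow> 'a) \<Rightarrow> nat" where
  "agreement t u = (LEAST i. t i \<noteq> u i)"

text \<open>Since the agreement is defined for distinct sequences only, the bound on it includes the
  distinctness of the two subsequences.\<close>

definition diversity_measure :: "(nat \<Rightarrow> 'a) \<Rightarrow> (nat \<Rightarrow> nat) \<Rightarrow> bool" where
  "diversity_measure s g \<longleftrightarrow>
     (\<forall>r a b. a < b \<and> b < r \<longrightarrow>
        (\<lambda>i. s (r * i + a)) \<noteq> (\<lambda>i. s (r * i + b)) \<and>
        agreement (\<lambda>i. s (r * i + a)) (\<lambda>i. s (r * i + b)) \<le> g r)"

end

theory Submission
  imports Defs "HOL-Analysis.Kronecker_Approximation_Theorem" "HOL-Number_Theory.Cong"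
begin

text \<open>
  The letter \<open>s i\<close> is \<open>1\<close> iff \<open>(i + 1) * \<theta>\<close> lies modulo 1 in \<open>[1 - \<theta>, 1)\<close>. Hence the letters at
  \<open>r * i + a\<close> and \<open>r * i + b\<close> differ as soon as \<open>(r * i + a + 1) * \<theta>\<close> hits a certain arc of length
  \<open>1 / ((B + 2) * r)\<close>, because the distance from \<open>m * \<theta>\<close> to the nearest integer is at least
  \<open>1 / ((B + 2) * m)\<close> for every \<open>m \<ge> 1\<close>. Put \<open>N = 2 * (B + 2)\<^sup>2 * r\<^sup>2\<close>. Dirichlet's theorem gives a
  fraction \<open>p / q\<close> in lowest terms with \<open>q \<le> N\<close> and \<open>\<bar>q * r * \<theta> - p\<bar> < 1 / N\<close>, and the same lower
  bound with \<open>m = q * r\<close> forces \<open>q > 2 * (B + 2) * r\<close>. Any \<open>q\<close> consecutive points of the rotation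
  by \<open>r * \<theta>\<close> are so close to a full set of \<open>q\<close>-th parts that they meet every arc of length
  \<open>2 / q < 1 / ((B + 2) * r)\<close>.
\<close>

section \<open>Continued fractions and bad approximability\<close>

text \<open>Before the shift the two sides differ by the integer
  \<open>\<lfloor>1 / \<theta>\<rfloor>\<close>. The next step of the recursion takes fractional
  parts and removes it, so agreement starts at \<open>Suc i\<close>.\<close>

lemma complete_quotient_Gauss_map:
  assumes "0 < \<theta>" "\<theta> < 1"
  shows "complete_quotient (frac (1 / \<theta>)) (Suc i) = complete_quotient \<theta> (Suc (Suc i))"
proof -
  have "frac \<theta> = \<theta>"
    using assms by (simp add: frac_eq)
  then show ?thesis
    by (induction i) simp_all
qed

lemma partial_quotients_bounded_by_Gauss_map:
  assumes "0 < \<theta>" "\<theta> < 1" "partial_quotients_bounded_by \<theta> B"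
  shows "partial_quotients_bounded_by (frac (1 / \<theta>)) B"
  unfolding partial_quotients_bounded_by_def
proof (intro allI impI)
  fix i :: nat
  assume "1 \<le> i"
  then obtain j where "i = Suc j"
    by (cases i) auto
  then have "partial_quotient (frac (1 / \<theta>)) i = partial_quotient \<theta> (Suc i)"
    using complete_quotient_Gauss_map[OF assms(1,2)] by (simp add: partial_quotient_def)
  then show "\<bar>partial_quotient (frac (1 / \<theta>)) i\<bar> \<le> int B"
    using assms(3) unfolding partial_quotients_bounded_by_def by simp
qed

text \<open>
  The shape of the bound is invariant under one step of the continued fraction algorithm: with
  \<open>a = \<lfloor>1 / \<theta>\<rfloor>\<close>, the substitution \<open>(m, n, \<theta>, t) \<mapsto> (n, m - a * n, 1 / \<theta> - a, 1 / (a + t))\<close> divides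
  both sides by \<open>\<theta> * (a + t)\<close>.
\<close>

lemma linear_form_lower_bound:
  fixes m n :: nat
  assumes "0 < \<theta>" "\<theta> < 1" "\<theta> \<notin> \<rat>" "partial_quotients_bounded_by \<theta> B"
    and "0 \<le> t" "t \<le> 1" "1 \<le> m"
  shows "1 + t * \<theta> \<le> (real B + 2) * (real m + t * real n) * \<bar>real m * \<theta> - real n\<bar>"
  using assms
proof (induction "m + n" arbitrary: m n \<theta> t rule: less_induct)
  case less
  note \<theta> = \<open>0 < \<theta>\<close> \<open>\<theta> < 1\<close>
  define a where "a = nat \<lfloor>1 / \<theta>\<rfloor>"
  define \<phi> where "\<phi> = frac (1 / \<theta>)"
  have a: "real a = of_int \<lfloor>1 / \<theta>\<rfloor>" "1 \<le> a"
    using \<theta> by (auto simp: a_def le_nat_iff le_floor_iff)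
  have \<phi>: "\<phi> = 1 / \<theta> - real a"
    by (simp add: \<phi>_def frac_def a)
  have \<phi>_irrat: "\<phi> \<notin> \<rat>"
  proof
    assume "\<phi> \<in> \<rat>"
    then have "\<phi> + real a \<in> \<rat>"
      by simp
    then have "1 / \<theta> \<in> \<rat>"
      by (simp add: \<phi>)
    then have "1 / (1 / \<theta>) \<in> \<rat>"
      by (rule Rats_divide[OF Rats_1])
    then show False
      using less.prems by simp
  qed
  have \<phi>_range: "0 < \<phi>" "\<phi> < 1"
    using \<phi>_irrat frac_ge_0[of "1 / \<theta>"] frac_lt_1[of "1 / \<theta>"] Rats_0
    unfolding \<phi>_def by (metis less_le)+
  have "partial_quotient \<theta> 1 = int a"
    using \<theta> a by (simp add: partial_quotient_def frac_eq a_def)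
  then have "a \<le> B"
    using less.prems(4) unfolding partial_quotients_bounded_by_def by fastforce
  then have "1 / \<theta> \<le> real B + 1"
    using \<phi> \<phi>_range by linarith
  then have "1 \<le> (real B + 1) * \<theta>"
    using \<theta> by (simp add: field_simps)
  moreover have "t * \<theta> \<le> \<theta>"
    using \<theta> less.prems by (simp add: mult_left_le_one_le)
  \<comment> \<open>Origin of the constant \<open>B + 2\<close>: \<open>a \<le> B\<close> gives
    \<open>1 \<le> (B + 1) * \<theta>\<close>, and one more \<open>\<theta>\<close> absorbs
    \<open>t * \<theta>\<close>.\<close>
  ultimately have \<theta>_large: "1 + t * \<theta> \<le> (real B + 2) * \<theta>"
    by (simp add: algebra_simps)
  have a\<theta>: "real a * \<theta> < 1"
  proof -
    have "real a < 1 / \<theta>"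
      using \<phi> \<phi>_range by linarith
    then show ?thesis
      using \<theta> by (simp add: less_divide_eq)
  qed
  \<comment> \<open>The substitution applies when the new pair \<open>(n, m - a * n)\<close>
    consists of naturals with positive first entry. Otherwise the linear form is at least
    \<open>\<theta>\<close> and \<open>\<theta>_large\<close> suffices.\<close>
  show ?case
  proof (cases "n \<ge> 1 \<and> a * n \<le> m")
    case True
    define k where "k = m - a * n"
    have k: "real k = real m - real a * real n"
      using True by (simp add: k_def of_nat_diff)
    define u where "u = 1 / (real a + t)"
    have at: "1 \<le> real a + t"
      using a less.prems by simp
    have u: "0 \<le> u" "u \<le> 1" "(real a + t) * u = 1"
      using at by (auto simp: u_def)
    have "n + k < m + n"
    proof -
      have "n \<le> a * n"
        using a by simp
      then show ?thesis
        using True unfolding k_def by linarith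
    qed
    then have "1 + u * \<phi> \<le> (real B + 2) * (real n + u * real k) * \<bar>real n * \<phi> - real k\<bar>"
      using less.hyps[of n k \<phi> u] \<phi>_range \<phi>_irrat u True \<theta>
        partial_quotients_bounded_by_Gauss_map[OF \<theta> less.prems(4)]
      by (simp add: \<phi>_def)
    then have "(\<theta> * (real a + t)) * (1 + u * \<phi>)
        \<le> (\<theta> * (real a + t)) * ((real B + 2) * (real n + u * real k) * \<bar>real n * \<phi> - real k\<bar>)"
      using \<theta> at by (intro mult_left_mono) auto
    also have "\<dots> = (real B + 2) * ((real a + t) * (real n + u * real k))
        * (\<theta> * \<bar>real n * \<phi> - real k\<bar>)"
      by (simp only: mult_ac)
    also have "(real a + t) * (real n + u * real k) = real m + t * real n"
    proof -
      have "(real a + t) * (real n + u * real k) = (real a + t) * real n + ((real a + t) * u) * real k"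
        by (simp add: algebra_simps)
      then show ?thesis
        unfolding u(3) k by (simp add: algebra_simps)
    qed
    also have "\<theta> * \<bar>real n * \<phi> - real k\<bar> = \<bar>real m * \<theta> - real n\<bar>"
    proof -
      have "\<theta> * \<bar>real n * \<phi> - real k\<bar> = \<bar>\<theta> * (real n * \<phi> - real k)\<bar>"
        using \<theta> by (simp add: abs_mult)
      also have "\<theta> * (real n * \<phi> - real k) = - (real m * \<theta> - real n)"
        using \<theta> by (simp add: \<phi> k field_simps)
      finally show ?thesis
        by simp
    qed
    also have "(\<theta> * (real a + t)) * (1 + u * \<phi>) = 1 + t * \<theta>"
    proof -
      have "(\<theta> * (real a + t)) * (1 + u * \<phi>) = \<theta> * (real a + t) + ((real a + t) * u) * (\<theta> * \<phi>)"
        by (simp add: algebra_simps)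
      then show ?thesis
        unfolding u(3) using \<theta> by (simp add: \<phi> field_simps)
    qed
    finally show ?thesis .
  next
    case False
    \<comment> \<open>Either \<open>n = 0\<close>, or \<open>m + 1 \<le> a * n\<close>; then
      \<open>a * \<theta> < 1\<close> places \<open>n\<close> at least \<open>\<theta>\<close> above
      \<open>m * \<theta>\<close>.\<close>
    have "\<theta> \<le> \<bar>real m * \<theta> - real n\<bar>"
    proof (cases "n = 0")
      case True
      then show ?thesis
        using \<theta> \<open>1 \<le> m\<close> by simp
    next
      case n: False
      then have "m + 1 \<le> a * n"
        using False by auto
      then have "real m + 1 \<le> real a * real n"
        by (metis of_nat_1 of_nat_add of_nat_le_iff of_nat_mult)
      then have "(real m + 1) * \<theta> \<le> real a * real n * \<theta>"
        using \<theta> by (intro mult_right_mono) auto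
      also have "\<dots> = (real a * \<theta>) * real n"
        by simp
      also have "\<dots> \<le> real n"
        using a\<theta> \<theta> by (intro mult_left_le_one_le) auto
      finally show ?thesis
        by (simp add: algebra_simps)
    qed
    moreover have "1 \<le> real m + t * real n"
      using \<open>1 \<le> m\<close> \<open>0 \<le> t\<close> by (simp add: add_increasing2)
    ultimately have "1 * \<theta> \<le> (real m + t * real n) * \<bar>real m * \<theta> - real n\<bar>"
      using \<theta> by (intro mult_mono) auto
    then have "(real B + 2) * \<theta> \<le> (real B + 2) * ((real m + t * real n) * \<bar>real m * \<theta> - real n\<bar>)"
      by (intro mult_left_mono) auto
    then show ?thesis
      using \<theta>_large unfolding mult.assoc by (rule order_trans[rotated])
  qed
qed

text \<open>For \<open>n \<ge> 0\<close> this is the preceding inequality at \<open>t = 0\<close>;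
  the parameter \<open>t\<close> there serves the induction, which turns \<open>t = 0\<close> into
  \<open>1 / a\<close>. For \<open>n < 0\<close> the distance is at least 1.\<close>

lemma bounded_partial_quotients_imp_badly_approximable:
  fixes m :: nat and n :: int
  assumes "0 < \<theta>" "\<theta> < 1" "\<theta> \<notin> \<rat>" "partial_quotients_bounded_by \<theta> B" "1 \<le> m"
  shows "1 / ((real B + 2) * real m) \<le> \<bar>real m * \<theta> - of_int n\<bar>"
proof (cases "0 \<le> n")
  case True
  then obtain k where k: "n = int k"
    by (metis nonneg_int_cases)
  have "1 \<le> (real B + 2) * real m * \<bar>real m * \<theta> - real k\<bar>"
    using linear_form_lower_bound[OF assms(1-4), of 0 m k] assms(5) by simp
  then show ?thesis
    using assms(5) by (simp add: k divide_le_eq mult.commute)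
next
  case False
  then have "real_of_int n \<le> - 1"
    by linarith
  moreover have "0 \<le> real m * \<theta>"
    using assms(1) by simp
  ultimately have "1 \<le> \<bar>real m * \<theta> - of_int n\<bar>"
    by linarith
  moreover have "1 / ((real B + 2) * real m) \<le> 1"
  proof -
    have "1 * 1 \<le> (real B + 2) * real m"
      using assms(5) by (intro mult_mono) auto
    then show ?thesis
      by simp
  qed
  ultimately show ?thesis
    by linarith
qed

section \<open>Visits of a rotation to short arcs\<close>

text \<open>As \<open>p\<close> is invertible modulo \<open>q\<close>, some \<open>i < q\<close> has
  \<open>p * i\<close> congruent to any prescribed \<open>j\<close>. Then
  \<open>i * \<alpha>\<close> is \<open>j / q\<close> modulo 1, up to an error
  \<open>i * \<eta> / q\<close> smaller than \<open>1 / q\<close>.\<close>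

lemma rotation_hits_arc:
  fixes p q :: int and \<alpha> x c :: real
  assumes "coprime p q" "0 < q" and close: "of_int q * \<bar>of_int q * \<alpha> - of_int p\<bar> \<le> 1"
  obtains i :: nat and k :: int
  where "int i < q" "c \<le> x + real i * \<alpha> - of_int k" "x + real i * \<alpha> - of_int k < c + 2 / of_int q"
proof -
  define \<eta> where "\<eta> = of_int q * \<alpha> - of_int p"
  \<comment> \<open>Round the left end of the arc up to a multiple of \<open>1 / q\<close>. If
    \<open>\<eta> < 0\<close> the error moves points to the left, so the target is one place further
    right.\<close>
  define j where "j = \<lceil>of_int q * (c - x)\<rceil> + (if 0 \<le> \<eta> then 0 else 1)"
  obtain v where v: "[p * v = 1] (mod q)"
    using cong_solve_coprime_int[OF assms(1)] by blast
  define i where "i = nat ((v * j) mod q)"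
  have i: "int i = (v * j) mod q"
    using assms(2) by (simp add: i_def)
  have "[p * int i = j] (mod q)"
  proof -
    have "[p * int i = p * (v * j)] (mod q)"
      unfolding i by (intro cong_mult cong_refl) simp
    also have "[p * (v * j) = 1 * j] (mod q)"
      using cong_mult[OF v cong_refl[of j]] by (simp add: mult.assoc)
    finally show ?thesis
      by simp
  qed
  then obtain k where k: "p * int i = j + q * k"
    by (metis cong_iff_lin cong_sym)
  have "int i < q"
    using assms(2) by (simp add: i)
  have q: "0 < real_of_int q"
    using assms(2) by simp
  have scaled: "of_int q * (x + real i * \<alpha> - of_int k) = of_int q * x + of_int j + real i * \<eta>"
  proof -
    have "of_int p * real i = of_int j + of_int q * real_of_int k"
      using arg_cong[OF k, of real_of_int] by simp
    then show ?thesis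
      by (simp add: \<eta>_def algebra_simps)
  qed
  have dev: "\<bar>real i * \<eta>\<bar> < 1"
  proof (cases "\<eta> = 0")
    case False
    have "real i < of_int q"
      using \<open>int i < q\<close> by linarith
    then have "real i * \<bar>\<eta>\<bar> < of_int q * \<bar>\<eta>\<bar>"
      using False by (intro mult_strict_right_mono) simp_all
    also have "\<dots> \<le> 1"
      using close by (simp add: \<eta>_def)
    finally show ?thesis
      by (simp add: abs_mult)
  qed simp
  have "of_int q * c \<le> of_int q * x + of_int j + real i * \<eta> \<and>
      of_int q * x + of_int j + real i * \<eta> < of_int q * c + 2"
  proof (cases "0 \<le> \<eta>")
    case True
    then have "0 \<le> real i * \<eta>"
      by simp
    moreover have "of_int q * c - of_int q * x \<le> of_int j" "of_int j < of_int q * c - of_int q * x + 1"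
      using True by (simp_all add: j_def right_diff_distrib) linarith+
    ultimately show ?thesis
      using dev by linarith
  next
    case False
    then have "real i * \<eta> \<le> 0"
      by (simp add: mult_nonneg_nonpos)
    moreover have "of_int q * c - of_int q * x + 1 \<le> of_int j"
        "of_int j < of_int q * c - of_int q * x + 2"
      using False by (simp_all add: j_def right_diff_distrib) linarith+
    ultimately show ?thesis
      using dev by linarith
  qed
  then have "of_int q * c \<le> of_int q * (x + real i * \<alpha> - of_int k)"
      "of_int q * (x + real i * \<alpha> - of_int k) < of_int q * (c + 2 / of_int q)"
    using q by (simp_all add: scaled distrib_left)
  then show thesis
    using that[of i k] \<open>int i < q\<close> q by simp
qed

section \<open>Coding of the rotation by \<open>\<theta>\<close>\<close>

text \<open>For \<open>0 < \<theta> < 1\<close> this is the indicator of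
  \<open>1 - \<theta> \<le> frac x\<close>. The form with floors is defined on all reals and gives
  \<open>s i\<close> at \<open>x = (i + 1) * \<theta>\<close>.\<close>

definition rotation_letter :: "real \<Rightarrow> real \<Rightarrow> int" where
  "rotation_letter \<theta> x = \<lfloor>x + \<theta>\<rfloor> - \<lfloor>x\<rfloor>"

lemma rotation_letter_diff_of_int: "rotation_letter \<theta> (x - of_int k) = rotation_letter \<theta> x"
proof -
  have "\<lfloor>x - of_int k + \<theta>\<rfloor> = \<lfloor>x + \<theta>\<rfloor> - k"
    using floor_diff_of_int[of "x + \<theta>" k] by (simp add: algebra_simps)
  then show ?thesis
    by (simp add: rotation_letter_def)
qed

lemma rotation_letter_eq_0: "0 \<le> x \<Longrightarrow> x < 1 - \<theta> \<Longrightarrow> 0 < \<theta> \<Longrightarrow> rotation_letter \<theta> x = 0"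
  using floor_unique[of 0 x] floor_unique[of 0 "x + \<theta>"] by (simp add: rotation_letter_def)

lemma rotation_letter_eq_1:
  "1 - \<theta> \<le> x \<Longrightarrow> x < 1 \<Longrightarrow> 0 < \<theta> \<Longrightarrow> \<theta> < 1 \<Longrightarrow> rotation_letter \<theta> x = 1"
  using floor_unique[of 0 x] floor_unique[of 1 "x + \<theta>"] by (simp add: rotation_letter_def)

text \<open>The letter changes at \<open>1 - \<theta>\<close>. An arc just before this point works
  if \<open>\<delta> \<le> \<theta>\<close>, since the shift by \<open>\<delta>\<close> crosses it
  but stays below 1; otherwise an arc just after it works, since the shift wraps around into the
  zeros.\<close>

lemma rotation_letters_differ_on_arc:
  assumes "0 < \<theta>" "\<theta> < 1" "0 < L"
    and "L \<le> \<theta>" "L \<le> 1 - \<theta>" "L \<le> \<delta>" "L \<le> 1 - \<delta>"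
  obtains c where
    "\<And>y. c \<le> y \<Longrightarrow> y < c + L \<Longrightarrow> rotation_letter \<theta> y \<noteq> rotation_letter \<theta> (y + \<delta>)"
proof (cases "\<delta> \<le> \<theta>")
  case True
  show thesis
  proof (rule that[of "1 - \<theta> - L"])
    fix y assume "1 - \<theta> - L \<le> y" "y < 1 - \<theta> - L + L"
    then have "rotation_letter \<theta> y = 0" "rotation_letter \<theta> (y + \<delta>) = 1"
      using assms True by (auto intro!: rotation_letter_eq_0 rotation_letter_eq_1)
    then show "rotation_letter \<theta> y \<noteq> rotation_letter \<theta> (y + \<delta>)"
      by simp
  qed
next
  case False
  show thesis
  proof (rule that[of "1 - \<theta>"])
    fix y assume "1 - \<theta> \<le> y" "y < 1 - \<theta> + L"
    then have "rotation_letter \<theta> y = 1" "rotation_letter \<theta> (y + \<delta> - of_int 1) = 0"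
      using assms False by (auto intro!: rotation_letter_eq_0 rotation_letter_eq_1)
    then show "rotation_letter \<theta> y \<noteq> rotation_letter \<theta> (y + \<delta>)"
      by (simp only: rotation_letter_diff_of_int)
  qed
qed

section \<open>Combination with Dirichlet approximation\<close>

lemma rotation_letters_differ_early:
  fixes r d B :: nat and \<theta> x :: real
  assumes \<theta>: "0 < \<theta>" "\<theta> < 1" "\<theta> \<notin> \<rat>" "partial_quotients_bounded_by \<theta> B"
    and d: "0 < d" "d < r"
  obtains i :: nat where "i \<le> 2 * (B + 2)\<^sup>2 * r\<^sup>2"
    and "rotation_letter \<theta> (x + real i * (real r * \<theta>))
      \<noteq> rotation_letter \<theta> (x + real i * (real r * \<theta>) + real d * \<theta>)"
proof -
  note bad = bounded_partial_quotients_imp_badly_approximable[OF \<theta>]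
  define N where "N = 2 * (B + 2)\<^sup>2 * r\<^sup>2"
  define L where "L = 1 / ((real B + 2) * real r)"
  define \<delta> where "\<delta> = frac (real d * \<theta>)"
  have "0 < r" "0 < N"
    using d by (auto simp: N_def)
  have L: "0 < L"
    using \<open>0 < r\<close> by (simp add: L_def)
  have L_le: "L \<le> \<bar>real m * \<theta> - of_int n\<bar>" if "1 \<le> m" "m \<le> r" for m n
  proof -
    have "L \<le> 1 / ((real B + 2) * real m)"
      unfolding L_def using that by (intro divide_left_mono mult_left_mono) auto
    then show ?thesis
      using bad[OF that(1), of n] by linarith
  qed
  have "L \<le> \<theta>" "L \<le> 1 - \<theta>"
    using L_le[of 1 0] L_le[of 1 1] d \<theta> by auto
  \<comment> \<open>The distances from \<open>d * \<theta>\<close> to its two neighbouring integers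
    are \<open>\<delta>\<close> and \<open>1 - \<delta>\<close>.\<close>
  moreover have "L \<le> \<delta>" "L \<le> 1 - \<delta>"
    using L_le[of d "\<lfloor>real d * \<theta>\<rfloor>"] L_le[of d "\<lfloor>real d * \<theta>\<rfloor> + 1"] d
    unfolding \<delta>_def frac_def by linarith+
  ultimately obtain c where
    c: "\<And>y. c \<le> y \<Longrightarrow> y < c + L \<Longrightarrow> rotation_letter \<theta> y \<noteq> rotation_letter \<theta> (y + \<delta>)"
    using rotation_letters_differ_on_arc[OF \<theta>(1,2) L] by metis
  obtain p q where pq: "coprime p q" "0 < q" "q \<le> int N"
    and approx: "\<bar>of_int q * (real r * \<theta>) - of_int p\<bar> < 1 / real N"
    using Dirichlet_approx_coprime[OF \<open>0 < N\<close>] by blast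
  have q: "0 < real_of_int q" "real_of_int q \<le> real N"
    using pq by linarith+
  \<comment> \<open>\<open>N\<close> is \<open>2 / L\<^sup>2\<close>: one factor
    \<open>1 / L\<close> cancels against the lower bound for the linear form, the other remains in
    \<open>q > 2 / L\<close>.\<close>
  have arc: "2 / of_int q < L"
  proof -
    define m where "m = nat q * r"
    have m: "real m = of_int q * real r" "1 \<le> m"
      using pq \<open>0 < r\<close> by (auto simp: m_def Suc_le_eq)
    have "1 / ((real B + 2) * real m) < 1 / real N"
      using bad[OF m(2), of p] approx by (simp add: m mult.assoc)
    then have "real N < (real B + 2) * (of_int q * real r)"
      using \<open>0 < N\<close> m(2) by (simp add: m(1)[symmetric] divide_less_eq less_divide_eq)
    also have "real N = (2 * ((real B + 2) * real r)) * ((real B + 2) * real r)"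
      by (simp add: N_def power2_eq_square algebra_simps)
    also have "(real B + 2) * (of_int q * real r) = of_int q * ((real B + 2) * real r)"
      by simp
    finally have "2 * ((real B + 2) * real r) < of_int q"
      by (rule mult_right_less_imp_less) simp
    then show ?thesis
      using q \<open>0 < r\<close> by (simp add: L_def divide_less_eq less_divide_eq)
  qed
  \<comment> \<open>Since \<open>q \<le> N\<close>, Dirichlet's error \<open>1 / N\<close> is small
    enough for all points with \<open>i < q\<close>.\<close>
  have "of_int q * \<bar>of_int q * (real r * \<theta>) - of_int p\<bar> \<le> real N * (1 / real N)"
    using approx q by (intro mult_mono) auto
  then have "of_int q * \<bar>of_int q * (real r * \<theta>) - of_int p\<bar> \<le> 1"
    using \<open>0 < N\<close> by simp
  then obtain i k where i: "int i < q" and y: "c \<le> x + real i * (real r * \<theta>) - of_int k"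
      "x + real i * (real r * \<theta>) - of_int k < c + 2 / of_int q"
    using rotation_hits_arc[OF pq(1,2)] by metis
  have "rotation_letter \<theta> (x + real i * (real r * \<theta>) - of_int k)
      \<noteq> rotation_letter \<theta> (x + real i * (real r * \<theta>) - of_int k + \<delta>)"
    using c y arc by auto
  moreover have "x + real i * (real r * \<theta>) - of_int k + \<delta>
      = x + real i * (real r * \<theta>) + real d * \<theta> - of_int (k + \<lfloor>real d * \<theta>\<rfloor>)"
    by (simp add: \<delta>_def frac_def)
  ultimately have "rotation_letter \<theta> (x + real i * (real r * \<theta>))
      \<noteq> rotation_letter \<theta> (x + real i * (real r * \<theta>) + real d * \<theta>)"
    by (simp only: rotation_letter_diff_of_int not_False_eq_True)
  moreover have "i \<le> N"
    using i pq by linarith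
  ultimately show thesis
    using that by (simp add: N_def)
qed

theorem theorem9:
  fixes B :: nat and \<theta> :: real and s :: "nat \<Rightarrow> int"
  assumes "B \<ge> 1"
    and "0 < \<theta>" and "\<theta> < 1" and "\<theta> \<notin> \<rat>"
    and "partial_quotients_bounded_by \<theta> B"
    and "\<And>i. s i = \<lfloor>real (i + 2) * \<theta>\<rfloor> - \<lfloor>real (i + 1) * \<theta>\<rfloor>"
  shows "diversity_measure s (\<lambda>r. 2 * (B + 2)\<^sup>2 * r\<^sup>2)"
  unfolding diversity_measure_def
proof (intro allI impI)
  fix r a b :: nat
  assume ab: "a < b \<and> b < r"
  have s: "s i = rotation_letter \<theta> (real (i + 1) * \<theta>)" for i
    unfolding assms(6) rotation_letter_def by (simp add: algebra_simps)
  obtain i where i: "i \<le> 2 * (B + 2)\<^sup>2 * r\<^sup>2"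
    and neq: "rotation_letter \<theta> (real (a + 1) * \<theta> + real i * (real r * \<theta>))
      \<noteq> rotation_letter \<theta> (real (a + 1) * \<theta> + real i * (real r * \<theta>) + real (b - a) * \<theta>)"
    using rotation_letters_differ_early[OF assms(2-5), of "b - a" r "real (a + 1) * \<theta>"] ab
    by (metis less_imp_diff_less zero_less_diff)
  \<comment> \<open>The orbit of \<open>(a + 1) * \<theta>\<close> under rotation by
    \<open>r * \<theta>\<close> codes the first subsequence; its translate by
    \<open>(b - a) * \<theta>\<close> codes the second.\<close>
  have "real (a + 1) * \<theta> + real i * (real r * \<theta>) = real (r * i + a + 1) * \<theta>"
    by (simp add: algebra_simps)
  moreover have "real (a + 1) * \<theta> + real i * (real r * \<theta>) + real (b - a) * \<theta>
      = real (r * i + b + 1) * \<theta>"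
    using ab by (simp add: of_nat_diff algebra_simps)
  ultimately have differ: "s (r * i + a) \<noteq> s (r * i + b)"
    using neq by (simp only: s not_False_eq_True)
  then have "agreement (\<lambda>i. s (r * i + a)) (\<lambda>i. s (r * i + b)) \<le> i"
    unfolding agreement_def by (rule Least_le)
  then show "(\<lambda>i. s (r * i + a)) \<noteq> (\<lambda>i. s (r * i + b)) \<and>
      agreement (\<lambda>i. s (r * i + a)) (\<lambda>i. s (r * i + b)) \<le> 2 * (B + 2)\<^sup>2 * r\<^sup>2"
    using differ i by (auto dest: fun_cong)
qed

end
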